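(* Let $Q=1+\sum_{j=1}^{p}(q_j-1)$. For every subsample $X_s$ of size $n$ whose information matrix $M_s=Z_s^TZ_s$ is nonsingular, $$\max_{x\in\mathcal{X}}E\bigl[(Y-z^T\hat\beta_s)^2\,\big|\,X_s\bigr]\ \ge\ \sigma^2\left(1+\frac{Q}{n}\right),$$ where $z$ is the dummy-coded vector of $x$, $Y$ is the response at $x$, and $\hat\beta_s=(Z_s^TZ_s)^{-1}Z_s^Ty_s$. Equality holds if $f(X_s)=0$, where $$f(X_s)=\sqrt{\sum_{j=1}^{p}\sum_{u=1}^{q_j}q_j^2\left[\frac{1}{q_j}-\frac{n_j(u)}{n}\right]^2+\sum_{j=1}^{p}\sum_{\substack{k=1\\k\ne j}}^{p}\sum_{u=1}^{q_j}\sum_{v=1}^{q_k}q_jq_k\left[\frac{1}{q_jq_k}-\frac{n_{jk}(u,v)}{n}\right]^2}.$$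
   Context: The full data are an $N\times p$ matrix $X=(x_1,\ldots,x_N)^T$, whose row $x_i=(x_{i1},\ldots,x_{ip})^T$ contains the values of $p$ categorical predictors with $q_1,\ldots,q_p$ levels, $x_{ij}\in\{1,\ldots,q_j\}$. The set of all level combinations is $\mathcal{X}=\{x=(x_1,\ldots,x_p): x_j\in\{1,\ldots,q_j\},\ j=1,\ldots,p\}$. Dummy coding: a point $x\in\mathcal{X}$ is coded as the vector $z\in\mathbb{R}^Q$ whose first entry is $1$ (intercept) and whose remaining entries are, for $j=1,\ldots,p$ and $k=1,\ldots,q_j-1$, equal to $1$ if $x_j=k$ and $0$ otherwise (level $q_j$ is the baseline). $Z$ is the $N\times Q$ matrix whose rows are the coded rows of $X$. It is assumed that $Z^TZ$ is nonsingular. A subsample $X_s$ of size $n$ (with $n\geq 1$) is an $n\times p$ matrix formed by $n$ of the $N$ rows of $X$. $Z_s$ is the matrix formed by the corresponding $n$ rows of $Z$. The response vector of the subsample is $y_s=Z_s\beta+\varepsilon_s$, where $\beta\in\mathbb{R}^Q$ is the fixed parameter vector and the entries of $\varepsilon_s$ are independent with mean $0$ and variance $\sigma^2$. For $x\in\mathcal{X}$ with coded vector $z$, the response $Y$ at $x$ is a random variable with $E(Y)=z^T\beta$ and $\mathrm{Var}(Y)=\sigma^2$, independent of $y_s$. Conditioning on $X_s$ means that the subsample points are treated as fixed and the expectation is over the random errors. $n_j(u)$ is the number of rows of $X_s$ in which the $j$th predictor takes level $u$. $n_{jk}(u,v)$ is the number of rows of $X_s$ in which the $j$th predictor takes level $u$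 and the $k$th predictor takes level $v$. *)

theory Defs
  imports
    "HOL-Probability.Probability"
    "Jordan_Normal_Form.Gauss_Jordan_Elimination"
begin

unbundle no vec_syntax
no_notation inner (infix "\<bullet>" 70)
hide_type (open) Finite_Cartesian_Product.vec
hide_const (open) Finite_Cartesian_Product.vec Finite_Cartesian_Product.mat
  Finite_Cartesian_Product.row Finite_Cartesian_Product.rows

text \<open>
  Predictors are numbered \<open>0, \<dots>, p - 1\<close> and data rows from \<open>0\<close>, so that they can serve directly
  as matrix indices; the levels of predictor \<open>j\<close> are \<open>1, \<dots>, q j\<close>.
\<close>

definition level_combinations :: "nat \<Rightarrow> (nat \<Rightarrow> nat) \<Rightarrow> nat vec set" where
  "level_combinations p q = {x \<in> carrier_vec p. \<forall>j<p. x $ j \<in> {1..q j}}"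

definition num_params :: "nat \<Rightarrow> (nat \<Rightarrow> nat) \<Rightarrow> nat" where
  "num_params p q = 1 + (\<Sum>j<p. (q j - 1))"

text \<open>
  The list \<open>[1..<q j]\<close> consists of \<open>1, \<dots>, q j - 1\<close>: level \<open>q j\<close> is the baseline.
\<close>

definition dummy_code :: "nat \<Rightarrow> (nat \<Rightarrow> nat) \<Rightarrow> nat vec \<Rightarrow> real vec" where
  "dummy_code p q x = vec_of_list
     (1 # concat (map (\<lambda>j. map (\<lambda>k. if x $ j = k then 1 else 0) [1..<q j]) [0..<p]))"

definition model_matrix :: "nat \<Rightarrow> (nat \<Rightarrow> nat) \<Rightarrow> nat mat \<Rightarrow> real mat" where
  "model_matrix p q X = mat_of_rows (num_params p q) (map (dummy_code p q) (rows X))"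

text \<open>
  A subsample is given by the list of the (distinct) row indices that are selected.
\<close>

definition select_rows :: "'a mat \<Rightarrow> nat list \<Rightarrow> 'a mat" where
  "select_rows A s = mat_of_rows (dim_col A) (map (row A) s)"

text \<open>
  \<open>mat_inverse\<close> returns an option, which is not \<open>None\<close> when \<open>Z\<^sup>T Z\<close> is invertible.
\<close>

definition ols_estimate :: "real mat \<Rightarrow> real vec \<Rightarrow> real vec" where
  "ols_estimate Z y = (the (mat_inverse (Z\<^sup>T * Z)) * Z\<^sup>T) *\<^sub>v y"

definition level_count :: "nat mat \<Rightarrow> nat \<Rightarrow> nat \<Rightarrow> nat" where
  "level_count A j u = card {i. i < dim_row A \<and> A $$ (i, j) = u}"

definition pair_count :: "nat mat \<Rightarrow> nat \<Rightarrow> nat \<Rightarrow> nat \<Rightarrow> nat \<Rightarrow> nat" where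
  "pair_count A j k u v = card {i. i < dim_row A \<and> A $$ (i, j) = u \<and> A $$ (i, k) = v}"

definition imbalance :: "nat \<Rightarrow> (nat \<Rightarrow> nat) \<Rightarrow> nat mat \<Rightarrow> real" where
  "imbalance p q A = (let n = real (dim_row A) in sqrt (
     (\<Sum>j<p. \<Sum>u=1..q j. (real (q j))\<^sup>2 * (1 / real (q j) - real (level_count A j u) / n)\<^sup>2) +
     (\<Sum>j<p. \<Sum>k\<in>{..<p} - {j}. \<Sum>u=1..q j. \<Sum>v=1..q k. real (q j) * real (q k) *
        (1 / (real (q j) * real (q k)) - real (pair_count A j k u v) / n)\<^sup>2)))"

context prob_space
begin

text \<open>
  Square integrability is explicit because the Bochner integral of a non-integrable function is
  \<open>0\<close> by convention.
\<close>

definition has_mean_variance :: "('a \<Rightarrow> real) \<Rightarrow> real \<Rightarrow> real \<Rightarrow> bool" where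
  "has_mean_variance X m v \<longleftrightarrow>
     random_variable borel X \<and> integrable M X \<and> integrable M (\<lambda>\<omega>. (X \<omega>)\<^sup>2) \<and>
     expectation X = m \<and> variance X = v"

text \<open>
  The library's \<open>indep_var\<close> requires both random variables to have the same value type. This is
  its characterisation \<open>indep_var_eq\<close>, for two possibly different value types.
\<close>

definition indep_rvs :: "'b measure \<Rightarrow> ('a \<Rightarrow> 'b) \<Rightarrow> 'c measure \<Rightarrow> ('a \<Rightarrow> 'c) \<Rightarrow> bool" where
  "indep_rvs S X T Y \<longleftrightarrow>
     random_variable S X \<and> random_variable T Y \<and>
     indep_set
       (sigma_sets (space M) {X -` A \<inter> space M | A. A \<in> sets S})
       (sigma_sets (space M) {Y -` A \<inter> space M | A. A \<in> sets T})"

text \<open>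
  Vectors carry no measurable structure in the library, so a random vector of dimension \<open>n\<close> is
  viewed as the family of its components in the product space.
\<close>

definition indep_of_vec :: "('a \<Rightarrow> real) \<Rightarrow> nat \<Rightarrow> ('a \<Rightarrow> real vec) \<Rightarrow> bool" where
  "indep_of_vec Y n y \<longleftrightarrow>
     indep_rvs borel Y (Pi\<^sub>M {..<n} (\<lambda>_. borel)) (\<lambda>\<omega>. \<lambda>i\<in>{..<n}. y \<omega> $ i)"

end

end

theory Submission
  imports Defs
begin

text \<open>
  With \<open>A = (Z\<^sub>s\<^sup>T Z\<^sub>s)\<inverse>\<close> the prediction error at \<open>x\<close> has mean square \<open>\<sigma>\<^sup>2 (1 + z\<^sup>T A z)\<close>. Summed over
  the subsample points, \<open>z\<^sup>T A z\<close> gives the trace of \<open>A Z\<^sub>s\<^sup>T Z\<^sub>s = I\<close>, that is \<open>Q\<close>, so at some of these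
  points it is at least \<open>Q / n\<close>. If the imbalance vanishes, then the function
  \<open>K x y = (1 + (\<Sum>j. (q\<^sub>j [x\<^sub>j = y\<^sub>j] - 1))) / n\<close> is additive in \<open>y\<close>, hence of the form \<open>z(y)\<^sup>T w\<close>, and the
  balance conditions say that \<open>Z\<^sub>s\<^sup>T Z\<^sub>s w = z(x)\<close>. Therefore \<open>z(x)\<^sup>T A z(x) = z(x)\<^sup>T w = K x x = Q / n\<close> at
  every \<open>x\<close>.
\<close>

section \<open>Moments of independent random variables\<close>

text \<open>Serves to remove the cross terms, both among the errors and between a new response and
  the noise of its prediction; one centred factor suffices.\<close>

lemma (in prob_space) indep_var_uncorrelated:
  fixes X Y :: "'a \<Rightarrow> real"
  assumes ind: "indep_var borel X borel Y"
    and X: "has_mean_variance X m v" and Y: "has_mean_variance Y 0 w"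
  shows "integrable M (\<lambda>\<omega>. X \<omega> * Y \<omega>)" "expectation (\<lambda>\<omega>. X \<omega> * Y \<omega>) = 0"
proof -
  have XY: "integrable M X" "integrable M Y" "expectation Y = 0"
    using X Y by (auto simp: has_mean_variance_def)
  show "integrable M (\<lambda>\<omega>. X \<omega> * Y \<omega>)"
    by (rule indep_var_integrable[OF ind XY(1,2)])
  show "expectation (\<lambda>\<omega>. X \<omega> * Y \<omega>) = 0"
    using indep_var_lebesgue_integral[OF ind XY(1,2)] XY(3) by simp
qed

text \<open>The square is a double sum over pairs of errors. Independence and zero means kill the
  off-diagonal terms, and each diagonal term contributes \<open>v\<close> times a squared
  coefficient.\<close>

lemma (in prob_space) has_mean_variance_linear_combination:
  fixes \<epsilon> :: "nat \<Rightarrow> 'a \<Rightarrow> real"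
  assumes ind: "indep_vars (\<lambda>_. borel) \<epsilon> {..<n}"
    and mv: "\<And>i. i < n \<Longrightarrow> has_mean_variance (\<epsilon> i) 0 v"
  shows "has_mean_variance (\<lambda>\<omega>. \<Sum>i<n. c i * \<epsilon> i \<omega>) 0 (v * (\<Sum>i<n. (c i)\<^sup>2))"
proof -
  have meas: "\<And>i. i < n \<Longrightarrow> random_variable borel (\<epsilon> i)"
    and int: "\<And>i. i < n \<Longrightarrow> integrable M (\<epsilon> i)"
    and sq: "\<And>i. i < n \<Longrightarrow> integrable M (\<lambda>\<omega>. \<epsilon> i \<omega> * \<epsilon> i \<omega>)"
    and mean: "\<And>i. i < n \<Longrightarrow> expectation (\<epsilon> i) = 0"
    using mv by (simp_all add: has_mean_variance_def power2_eq_square)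
  have var: "expectation (\<lambda>\<omega>. \<epsilon> i \<omega> * \<epsilon> i \<omega>) = v" if "i < n" for i
    using mv[OF that] by (auto simp: has_mean_variance_def power2_eq_square)
  have prod_int: "integrable M (\<lambda>\<omega>. \<epsilon> i \<omega> * \<epsilon> j \<omega>)"
    and prod_mean: "expectation (\<lambda>\<omega>. \<epsilon> i \<omega> * \<epsilon> j \<omega>) = (if i = j then v else 0)"
    if "i < n" "j < n" for i j
  proof (atomize (full), cases "i = j")
    case False
    \<comment> \<open>Pairwise independence comes from \<open>indep_vars_sum\<close> with the
      singleton \<open>{j}\<close>, over which the sum is \<open>\<epsilon> j\<close>
      itself.\<close>
    then have "indep_var borel (\<epsilon> i) borel (\<epsilon> j)"
      using indep_vars_sum[of "{j}" i \<epsilon>] indep_vars_subset[OF ind, of "{i, j}"] that by simp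
    from indep_var_uncorrelated[OF this mv mv] that False
    show "integrable M (\<lambda>\<omega>. \<epsilon> i \<omega> * \<epsilon> j \<omega>) \<and>
      expectation (\<lambda>\<omega>. \<epsilon> i \<omega> * \<epsilon> j \<omega>) = (if i = j then v else 0)" by auto
  qed (use sq var that in auto)
  let ?L = "\<lambda>\<omega>. \<Sum>i<n. c i * \<epsilon> i \<omega>"
  have L2: "(?L \<omega>)\<^sup>2 = (\<Sum>i<n. \<Sum>j<n. (c i * c j) * (\<epsilon> i \<omega> * \<epsilon> j \<omega>))" for \<omega>
    by (simp add: power2_eq_square sum_product mult_ac)
  have L_mean: "expectation ?L = 0"
    by (subst Bochner_Integration.integral_sum) (use int mean in auto)
  have term_int: "integrable M (\<lambda>\<omega>. (c i * c j) * (\<epsilon> i \<omega> * \<epsilon> j \<omega>))" if "i < n" "j < n" for i j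
    using prod_int[OF that] by (rule integrable_mult_right)
  have "expectation (\<lambda>\<omega>. (?L \<omega>)\<^sup>2)
      = (\<Sum>i<n. expectation (\<lambda>\<omega>. \<Sum>j<n. (c i * c j) * (\<epsilon> i \<omega> * \<epsilon> j \<omega>)))"
    unfolding L2
    by (intro Bochner_Integration.integral_sum Bochner_Integration.integrable_sum term_int) auto
  also have "\<dots> = (\<Sum>i<n. \<Sum>j<n. expectation (\<lambda>\<omega>. (c i * c j) * (\<epsilon> i \<omega> * \<epsilon> j \<omega>)))"
    by (intro sum.cong refl Bochner_Integration.integral_sum term_int) auto
  also have "\<dots> = (\<Sum>i<n. \<Sum>j<n. if i = j then c i * c j * v else 0)"
    by (intro sum.cong) (auto simp: prod_mean)
  also have "\<dots> = v * (\<Sum>i<n. (c i)\<^sup>2)"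
    by (simp add: sum_distrib_left power2_eq_square mult_ac)
  finally have var_L: "expectation (\<lambda>\<omega>. (?L \<omega>)\<^sup>2) = v * (\<Sum>i<n. (c i)\<^sup>2)" .
  have "integrable M (\<lambda>\<omega>. (?L \<omega>)\<^sup>2)"
    unfolding L2 by (intro Bochner_Integration.integrable_sum term_int) auto
  moreover have "random_variable borel ?L"
    using meas by (intro borel_measurable_sum borel_measurable_times) auto
  moreover have "integrable M ?L"
    using int by (intro Bochner_Integration.integrable_sum integrable_mult_right) auto
  ultimately show ?thesis
    unfolding has_mean_variance_def using L_mean var_L by simp
qed

text \<open>The prediction \<open>m + L\<close> is unbiased and uncorrelated with \<open>Y\<close>,
  so the two variances add up.\<close>

lemma (in prob_space) mean_square_prediction_error:
  fixes Y L :: "'a \<Rightarrow> real"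
  assumes ind: "indep_var borel Y borel L"
    and Y: "has_mean_variance Y m v" and L: "has_mean_variance L 0 w"
  shows "expectation (\<lambda>\<omega>. (Y \<omega> - (m + L \<omega>))\<^sup>2) = v + w"
proof -
  note YL = indep_var_uncorrelated[OF ind Y L]
  have int: "integrable M Y" "integrable M (\<lambda>\<omega>. (Y \<omega>)\<^sup>2)" "integrable M L" "integrable M (\<lambda>\<omega>. (L \<omega>)\<^sup>2)"
    and E: "expectation L = 0" "expectation (\<lambda>\<omega>. (Y \<omega> - m)\<^sup>2) = v" "expectation (\<lambda>\<omega>. (L \<omega>)\<^sup>2) = w"
    using Y L by (auto simp: has_mean_variance_def)
  have Ym: "integrable M (\<lambda>\<omega>. (Y \<omega> - m)\<^sup>2)"
    unfolding power2_diff using int by simp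
  \<comment> \<open>The cross term 2 (Y - m) L is split, so that uncorrelatedness handles
    \<open>Y \<omega> * L \<omega>\<close> and the zero mean of \<open>L\<close> the rest.\<close>
  have eq: "(Y \<omega> - (m + L \<omega>))\<^sup>2 = (Y \<omega> - m)\<^sup>2 - 2 * (Y \<omega> * L \<omega>) + 2 * m * L \<omega> + (L \<omega>)\<^sup>2" for \<omega>
    by (simp add: power2_eq_square algebra_simps)
  have "expectation (\<lambda>\<omega>. (Y \<omega> - (m + L \<omega>))\<^sup>2) =
     expectation (\<lambda>\<omega>. (Y \<omega> - m)\<^sup>2) - 2 * expectation (\<lambda>\<omega>. Y \<omega> * L \<omega>) + 2 * m * expectation L
       + expectation (\<lambda>\<omega>. (L \<omega>)\<^sup>2)"
    unfolding eq using int Ym YL(1) by simp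
  then show ?thesis
    using E YL(2) by simp
qed

text \<open>A function of the vector generates a smaller sigma-algebra than the vector, so
  independence is inherited. This leads from the response vector to the real-valued variables of the
  moment computations.\<close>

lemma (in prob_space) indep_of_vec_imp_indep_var:
  assumes ind: "indep_of_vec Y n y" and g: "g \<in> borel_measurable (Pi\<^sub>M {..<n} (\<lambda>_. borel))"
  shows "indep_var borel Y borel (\<lambda>\<omega>. g (\<lambda>i\<in>{..<n}. y \<omega> $ i))"
proof -
  let ?PM = "Pi\<^sub>M {..<n} (\<lambda>_. borel :: real measure)" and ?V = "\<lambda>\<omega>. \<lambda>i\<in>{..<n}. y \<omega> $ i"
  have Y: "random_variable borel Y" and V: "random_variable ?PM ?V"
    and indep: "indep_set
       (sigma_sets (space M) {Y -` A \<inter> space M | A. A \<in> sets borel})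
       (sigma_sets (space M) {?V -` A \<inter> space M | A. A \<in> sets ?PM})"
    using ind by (auto simp: indep_of_vec_def indep_rvs_def)
  have gV: "random_variable borel (\<lambda>\<omega>. g (?V \<omega>))"
    using measurable_compose[OF V g] .
  \<comment> \<open>The vector takes its values in \<open>space ?PM\<close>, so intersecting with it
    changes nothing and makes the inner preimage a measurable set.\<close>
  have "(\<lambda>\<omega>. g (?V \<omega>)) -` A \<inter> space M = ?V -` (g -` A \<inter> space ?PM) \<inter> space M" for A
    using measurable_space[OF V] by auto
  then have "sigma_sets (space M) {(\<lambda>\<omega>. g (?V \<omega>)) -` A \<inter> space M | A. A \<in> sets borel} \<subseteq>
      sigma_sets (space M) {?V -` A \<inter> space M | A. A \<in> sets ?PM}"
    by (intro sigma_sets_mono') (use measurable_sets[OF g] in blast)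
  then have "indep_set
       (sigma_sets (space M) {Y -` A \<inter> space M | A. A \<in> sets borel})
       (sigma_sets (space M) {(\<lambda>\<omega>. g (?V \<omega>)) -` A \<inter> space M | A. A \<in> sets borel})"
    using indep unfolding indep_sets2_eq by blast
  then show ?thesis
    using Y gV by (simp add: indep_var_eq)
qed

section \<open>Matrix algebra of least squares\<close>

text \<open>The summands are the diagonal entries of \<open>Z * A * Z\<^sup>T\<close>, whose trace
  equals that of \<open>A * (Z\<^sup>T * Z)\<close>, the identity of size \<open>m\<close>.\<close>

lemma sum_leverages:
  fixes Z A :: "real mat"
  assumes Z: "Z \<in> carrier_mat n m" and A: "A \<in> carrier_mat m m"
    and inv: "A * (Z\<^sup>T * Z) = 1\<^sub>m m"
  shows "(\<Sum>i<n. scalar_prod (row Z i) (A *\<^sub>v row Z i)) = real m"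
proof -
  have "real m = (\<Sum>a<m. (A * (Z\<^sup>T * Z)) $$ (a, a))"
    by (simp add: inv)
  also have "\<dots> = (\<Sum>a<m. \<Sum>b<m. \<Sum>i<n. A $$ (a, b) * (Z $$ (i, b) * Z $$ (i, a)))"
    using Z A by (simp add: scalar_prod_def atLeast0LessThan sum_distrib_left)
  also have "\<dots> = (\<Sum>a<m. \<Sum>i<n. \<Sum>b<m. A $$ (a, b) * (Z $$ (i, b) * Z $$ (i, a)))"
    by (intro sum.cong refl sum.swap)
  also have "\<dots> = (\<Sum>i<n. \<Sum>a<m. \<Sum>b<m. A $$ (a, b) * (Z $$ (i, b) * Z $$ (i, a)))"
    by (rule sum.swap)
  also have "\<dots> = (\<Sum>i<n. scalar_prod (row Z i) (A *\<^sub>v row Z i))"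
    using Z A by (simp add: scalar_prod_def atLeast0LessThan sum_distrib_left mult_ac)
  finally show ?thesis by simp
qed

text \<open>As \<open>A * Z\<^sup>T\<close> is a left inverse of \<open>Z\<close>, the estimate is
  \<open>b\<close> plus a linear image of the errors, and \<open>c\<close> collects their
  coefficients in the prediction at \<open>z\<close>. The squared length of \<open>c\<close> is the
  product of z^T, \<open>A\<close>, \<open>Z\<^sup>T * Z\<close>, \<open>A\<^sup>T\<close> and z,
  where the third and fourth factors cancel.\<close>

lemma ols_prediction:
  fixes Z A :: "real mat"
  assumes Z: "Z \<in> carrier_mat n m" and A: "A \<in> carrier_mat m m"
    and inv: "A * (Z\<^sup>T * Z) = 1\<^sub>m m"
    and z: "z \<in> carrier_vec m" and b: "b \<in> carrier_vec m" and e: "e \<in> carrier_vec n"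
  defines "c \<equiv> Z *\<^sub>v (A\<^sup>T *\<^sub>v z)"
  shows "scalar_prod z ((A * Z\<^sup>T) *\<^sub>v (Z *\<^sub>v b + e)) = scalar_prod z b + scalar_prod c e"
    and "scalar_prod c c = scalar_prod z (A *\<^sub>v z)"
proof -
  have AZ: "A * Z\<^sup>T \<in> carrier_mat m n" using A Z by simp
  have Az: "A\<^sup>T *\<^sub>v z \<in> carrier_vec m" using A z by simp
  have "(A * Z\<^sup>T) *\<^sub>v (Z *\<^sub>v b) = (A * (Z\<^sup>T * Z)) *\<^sub>v b"
    using A Z b by (simp add: assoc_mult_mat[of _ m m _ n _ m] assoc_mult_mat_vec[of _ m m _ m] assoc_mult_mat_vec[of _ m n _ m] assoc_mult_mat_vec[of _ m m _ n])
  also have "\<dots> = b" using inv b by simp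
  moreover have "(A * Z\<^sup>T) *\<^sub>v (Z *\<^sub>v b + e) = (A * Z\<^sup>T) *\<^sub>v (Z *\<^sub>v b) + (A * Z\<^sup>T) *\<^sub>v e"
    using Z b e by (intro mult_add_distrib_mat_vec[OF AZ]) auto
  moreover have "(A * Z\<^sup>T) *\<^sub>v e = A *\<^sub>v (Z\<^sup>T *\<^sub>v e)"
    using A Z e by (intro assoc_mult_mat_vec) auto
  ultimately have "(A * Z\<^sup>T) *\<^sub>v (Z *\<^sub>v b + e) = b + A *\<^sub>v (Z\<^sup>T *\<^sub>v e)"
    by simp
  moreover have "scalar_prod z (A *\<^sub>v (Z\<^sup>T *\<^sub>v e)) = scalar_prod c e"
  proof -
    have "scalar_prod z (A *\<^sub>v (Z\<^sup>T *\<^sub>v e)) = scalar_prod (A\<^sup>T *\<^sub>v z) (Z\<^sup>T *\<^sub>v e)"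
      using A Z z e by (intro transpose_vec_mult_scalar[symmetric]) auto
    also have "\<dots> = scalar_prod (Z\<^sup>T *\<^sub>v e) (A\<^sup>T *\<^sub>v z)"
      using Az Z e by (intro comm_scalar_prod[of _ m]) auto
    also have "\<dots> = scalar_prod e c"
      unfolding c_def using Z e Az by (intro transpose_vec_mult_scalar) auto
    also have "\<dots> = scalar_prod c e"
      unfolding c_def using Z e Az by (intro comm_scalar_prod[of _ n]) auto
    finally show ?thesis .
  qed
  ultimately show "scalar_prod z ((A * Z\<^sup>T) *\<^sub>v (Z *\<^sub>v b + e)) = scalar_prod z b + scalar_prod c e"
    using z b A Z e by (simp add: scalar_prod_add_distrib[of _ m])
  \<comment> \<open>Since \<open>Z\<^sup>T * Z\<close> is symmetric, transposing \<open>inv\<close>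
    makes \<open>A\<^sup>T\<close> a right inverse of it.\<close>
  have "(Z\<^sup>T * Z) * A\<^sup>T = (A * (Z\<^sup>T * Z))\<^sup>T"
    using A Z by (simp add: transpose_mult[of _ m m _ m] transpose_mult[of _ m n _ m])
  then have MA: "(Z\<^sup>T * Z) * A\<^sup>T = 1\<^sub>m m"
    by (simp add: inv)
  have "Z\<^sup>T *\<^sub>v c = (Z\<^sup>T * Z) *\<^sub>v (A\<^sup>T *\<^sub>v z)"
    unfolding c_def using Z Az by (intro assoc_mult_mat_vec[symmetric]) auto
  also have "\<dots> = ((Z\<^sup>T * Z) * A\<^sup>T) *\<^sub>v z"
    using A Z z by (intro assoc_mult_mat_vec[symmetric]) auto
  also have "\<dots> = z"
    using MA z by simp
  finally have Zc: "Z\<^sup>T *\<^sub>v c = z" .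
  have "scalar_prod c c = scalar_prod (Z\<^sup>T *\<^sub>v c) (A\<^sup>T *\<^sub>v z)"
    using Z Az unfolding c_def by (intro transpose_vec_mult_scalar[symmetric]) auto
  also have "\<dots> = scalar_prod (A\<^sup>T *\<^sub>v z) z"
    unfolding Zc using Az z by (intro comm_scalar_prod[of _ m]) auto
  also have "\<dots> = scalar_prod z (A *\<^sub>v z)"
    using A z by (intro transpose_vec_mult_scalar) auto
  finally show "scalar_prod c c = scalar_prod z (A *\<^sub>v z)" .
qed

text \<open>Links \<open>invertible_mat\<close> to the computed \<open>mat_inverse\<close>, whose
  failure is characterised by units of the matrix ring. It ensures that \<open>the\<close> in
  \<open>ols_estimate\<close> is applied to a genuine inverse.\<close>

lemma mat_inverse_Some:
  fixes M :: "'a :: field mat"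
  assumes M: "M \<in> carrier_mat m m" and inv: "invertible_mat M"
  obtains A where "mat_inverse M = Some A" "A \<in> carrier_mat m m" "A * M = 1\<^sub>m m"
proof -
  obtain B where B: "M * B = 1\<^sub>m m" "B * M = 1\<^sub>m (dim_row B)"
    using inv M by (auto simp: invertible_mat_def inverts_mat_def)
  \<comment> \<open>The dimensions of \<open>B\<close> are read off from the two identity
    matrices.\<close>
  have "dim_col B = m" "dim_row B = m"
    using arg_cong[OF B(1), of dim_col] arg_cong[OF B(2), of dim_col] M by auto
  with M B have "M \<in> Units (ring_mat TYPE('a) m ())"
    by (auto simp: Units_def ring_mat_def intro!: bexI[of _ B])
  then obtain A where "mat_inverse M = Some A"
    using mat_inverse(1)[OF M, of "()"] by (cases "mat_inverse M") auto
  with mat_inverse(2)[OF M this] that show ?thesis by auto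
qed

section \<open>Dummy coding, additive functions and the balanced kernel\<close>

text \<open>The coordinates of \<open>dummy_code\<close> as functions of the point. Membership in
  this list replaces index arithmetic in the concatenated code: a coordinate is the constant or the
  indicator of a non-baseline level.\<close>

definition dummy_functions :: "nat \<Rightarrow> (nat \<Rightarrow> nat) \<Rightarrow> (nat vec \<Rightarrow> real) list" where
  "dummy_functions p q =
     (\<lambda>_. 1) # concat (map (\<lambda>j. map (\<lambda>k x. of_bool (x $ j = k)) [1..<q j]) [0..<p])"

lemma length_dummy_functions: "length (dummy_functions p q) = num_params p q"
  by (simp add: dummy_functions_def num_params_def length_concat comp_def
      interv_sum_list_conv_sum_set_nat atLeast0LessThan)

lemma set_dummy_functions:
  "set (dummy_functions p q) = 
    insert (\<lambda>_. 1) (\<Union>j<p. (\<lambda>k x. of_bool (x $ j = k)) ` {1..<q j})"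
  by (simp add: dummy_functions_def atLeast0LessThan)

lemma level_indicator_in_dummy_functions:
  assumes "j < p" "1 \<le> k" "k < q j"
  shows "(\<lambda>x. of_bool (x $ j = k)) \<in> set (dummy_functions p q)"
  unfolding set_dummy_functions using assms
  by (intro insertI2 UN_I[of j] image_eqI[OF refl]) auto

lemma dummy_code_eq: "dummy_code p q x = vec_of_list (map (\<lambda>\<phi>. \<phi> x) (dummy_functions p q))"
  by (simp add: dummy_code_def dummy_functions_def map_concat comp_def of_bool_def)

lemma dummy_code_carrier: "dummy_code p q x \<in> carrier_vec (num_params p q)"
  by (rule carrier_vecI) (simp add: dummy_code_eq length_dummy_functions)

lemma dummy_code_index:
  "a < num_params p q \<Longrightarrow> dummy_code p q x $ a = (dummy_functions p q ! a) x"
  by (simp add: dummy_code_eq vec_of_list_index length_dummy_functions)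

text \<open>The span of the dummy coordinates, which consists of the sums of functions of one
  predictor each. Equality is asked only at valid points, because elsewhere the baseline indicator
  is not 1 minus the other indicators.\<close>

definition additive_functions :: "nat \<Rightarrow> (nat \<Rightarrow> nat) \<Rightarrow> (nat vec \<Rightarrow> real) set" where
  "additive_functions p q = {f. \<exists>w \<in> carrier_vec (num_params p q).
     \<forall>x \<in> level_combinations p q. f x = scalar_prod (dummy_code p q x) w}"

lemma additive_functions_cong:
  assumes "f \<in> additive_functions p q" "\<And>x. x \<in> level_combinations p q \<Longrightarrow> f x = g x"
  shows "g \<in> additive_functions p q"
  using assms by (auto simp: additive_functions_def)

lemma additive_functions_dummy:
  assumes "\<phi> \<in> set (dummy_functions p q)"
  shows "\<phi> \<in> additive_functions p q"
proof -
  obtain a where a: "a < num_params p q" "\<phi> = dummy_functions p q ! a"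
    using assms by (auto simp: in_set_conv_nth length_dummy_functions)
  then show ?thesis
    using dummy_code_carrier
    by (auto simp: additive_functions_def dummy_code_index intro!: bexI[of _ "unit_vec (num_params p q) a"])
qed

lemma additive_functions_add:
  assumes "f \<in> additive_functions p q" "g \<in> additive_functions p q"
  shows "(\<lambda>x. f x + g x) \<in> additive_functions p q"
proof -
  obtain v w where "v \<in> carrier_vec (num_params p q)" "w \<in> carrier_vec (num_params p q)"
    "\<And>x. x \<in> level_combinations p q \<Longrightarrow> f x = scalar_prod (dummy_code p q x) v"
    "\<And>x. x \<in> level_combinations p q \<Longrightarrow> g x = scalar_prod (dummy_code p q x) w"
    using assms by (auto simp: additive_functions_def)
  then show ?thesis
    unfolding additive_functions_def
    by (auto simp: scalar_prod_add_distrib[OF dummy_code_carrier] intro!: bexI[of _ "v + w"])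
qed

lemma additive_functions_scale:
  assumes "f \<in> additive_functions p q"
  shows "(\<lambda>x. c * f x) \<in> additive_functions p q"
proof -
  obtain v where "v \<in> carrier_vec (num_params p q)"
    "\<And>x. x \<in> level_combinations p q \<Longrightarrow> f x = scalar_prod (dummy_code p q x) v"
    using assms by (auto simp: additive_functions_def)
  then show ?thesis
    unfolding additive_functions_def
    by (auto simp: scalar_prod_smult_distrib[OF dummy_code_carrier] intro!: bexI[of _ "c \<cdot>\<^sub>v v"])
qed

lemma additive_functions_const: "(\<lambda>_. c) \<in> additive_functions p q"
  using additive_functions_scale[OF additive_functions_dummy, of "\<lambda>_. 1" p q c]
  by (simp add: set_dummy_functions)

lemma additive_functions_sum:
  assumes "finite J" "\<And>j. j \<in> J \<Longrightarrow> f j \<in> additive_functions p q"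
  shows "(\<lambda>x. \<Sum>j\<in>J. f j x) \<in> additive_functions p q"
  using assms
  by (induction J rule: finite_induct) (auto intro: additive_functions_const additive_functions_add)

text \<open>The baseline level has no coordinate of its own; at valid points its indicator is 1
  minus those of the other levels.\<close>

lemma additive_functions_indicator:
  assumes j: "j < p" and k: "k \<in> {1..q j}"
  shows "(\<lambda>x. of_bool (x $ j = k)) \<in> additive_functions p q"
proof (cases "k < q j")
  case True
  then show ?thesis
    using j k by (intro additive_functions_dummy level_indicator_in_dummy_functions) auto
next
  case False
  with k have k: "k = q j" by simp
  have "(\<lambda>x. 1 + (-1) * (\<Sum>l\<in>{1..<q j}. of_bool (x $ j = l))) \<in> additive_functions p q"
    using j
    by (intro additive_functions_add additive_functions_scale additive_functions_sum
        additive_functions_const additive_functions_dummy level_indicator_in_dummy_functions) auto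
  then show ?thesis
  proof (rule additive_functions_cong)
    fix x assume "x \<in> level_combinations p q"
    then have "x $ j \<in> {1..q j}" using j by (auto simp: level_combinations_def)
    then show "1 + (-1) * (\<Sum>l\<in>{1..<q j}. of_bool (x $ j = l)) = (of_bool (x $ j = k) :: real)"
      by (auto simp: k of_bool_def)
  qed
qed

text \<open>
  Under balance this is the reproducing kernel of the additive functions for the inner product
  given by summation over the subsample.
\<close>

definition balanced_kernel :: "nat \<Rightarrow> (nat \<Rightarrow> nat) \<Rightarrow> nat \<Rightarrow> nat vec \<Rightarrow> nat vec \<Rightarrow> real" where
  "balanced_kernel p q n x y = (1 + (\<Sum>j<p. real (q j) * of_bool (y $ j = x $ j) - 1)) / real n"

text \<open>For fixed \<open>x\<close> the kernel is a constant plus a linear combination of the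
  indicators of the levels \<open>x $ j\<close>, any of which may be a baseline level.\<close>

lemma balanced_kernel_additive:
  assumes "x \<in> level_combinations p q"
  shows "balanced_kernel p q n x \<in> additive_functions p q"
proof -
  have "(\<lambda>y. (1 / real n) * (1 + (\<Sum>j<p. real (q j) * of_bool (y $ j = x $ j) + (-1))))
      \<in> additive_functions p q"
    using assms
    by (intro additive_functions_scale additive_functions_add additive_functions_sum
        additive_functions_const additive_functions_indicator) (auto simp: level_combinations_def)
  then show ?thesis
    by (rule additive_functions_cong) (simp add: balanced_kernel_def)
qed

lemma balanced_kernel_diagonal:
  assumes "x \<in> level_combinations p q"
  shows "balanced_kernel p q n x x = real (num_params p q) / real n"
proof -
  \<comment> \<open>Each \<open>q j\<close> is at least 1 because \<open>x\<close> has a level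
    there, so the truncated subtraction in \<open>num_params\<close> is exact.\<close>
  have "(\<Sum>j<p. real (q j) - 1) = (\<Sum>j<p. real (q j - 1))"
    using assms by (intro sum.cong refl) (force simp: level_combinations_def)
  then show ?thesis
    by (simp add: balanced_kernel_def num_params_def)
qed

section \<open>Balance conditions and the reproducing property\<close>

lemma level_count_eq_sum:
  "real (level_count A j u) = (\<Sum>i<dim_row A. of_bool (A $$ (i, j) = u))"
  by (simp add: level_count_def sum.If_cases of_bool_def Int_def)

lemma pair_count_eq_sum:
  "real (pair_count A j k u v)
    = (\<Sum>i<dim_row A. of_bool (A $$ (i, j) = u) * of_bool (A $$ (i, k) = v))"
  unfolding of_bool_conj[symmetric] by (simp add: pair_count_def sum.If_cases of_bool_def Int_def)

text \<open>The radicand is a sum of squares with nonnegative weights, so it vanishes term by term.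
  Since all \<open>q j\<close> and the number of rows are positive, the weights can be cancelled and
  the equations solved for the counts.\<close>

lemma imbalance_eq_0D:
  assumes imb: "imbalance p q A = 0" and q: "\<And>j. j < p \<Longrightarrow> q j \<ge> 1" and A: "dim_row A \<ge> 1"
  shows "\<lbrakk>j < p; u \<in> {1..q j}\<rbrakk> \<Longrightarrow>
      (\<Sum>i<dim_row A. of_bool (A $$ (i, j) = u)) = real (dim_row A) / real (q j)"
    and "\<lbrakk>j < p; k < p; j \<noteq> k; u \<in> {1..q j}; v \<in> {1..q k}\<rbrakk> \<Longrightarrow>
      (\<Sum>i<dim_row A. of_bool (A $$ (i, j) = u) * of_bool (A $$ (i, k) = v))
        = real (dim_row A) / (real (q j) * real (q k))"
proof -
  let ?n = "real (dim_row A)"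
  let ?S = "\<lambda>j. \<Sum>u=1..q j. (real (q j))\<^sup>2 * (1 / real (q j) - real (level_count A j u) / ?n)\<^sup>2"
  let ?T = "\<lambda>j k. \<Sum>u=1..q j. \<Sum>v=1..q k. real (q j) * real (q k) *
        (1 / (real (q j) * real (q k)) - real (pair_count A j k u v) / ?n)\<^sup>2"
  have nonneg: "0 \<le> (\<Sum>j<p. ?S j)" "0 \<le> (\<Sum>j<p. \<Sum>k\<in>{..<p} - {j}. ?T j k)"
    by (intro sum_nonneg; simp)+
  have "(\<Sum>j<p. ?S j) + (\<Sum>j<p. \<Sum>k\<in>{..<p} - {j}. ?T j k) = 0"
    using imb by (simp add: imbalance_def Let_def)
  with nonneg have sums: "(\<Sum>j<p. ?S j) = 0" "(\<Sum>j<p. \<Sum>k\<in>{..<p} - {j}. ?T j k) = 0"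
    by linarith+
  show "(\<Sum>i<dim_row A. of_bool (A $$ (i, j) = u)) = ?n / real (q j)"
    if "j < p" "u \<in> {1..q j}" for j u
  proof -
    have "?S j = 0"
      using sums(1) that(1) by (subst (asm) sum_nonneg_eq_0_iff) (auto intro!: sum_nonneg)
    then have "(real (q j))\<^sup>2 * (1 / real (q j) - real (level_count A j u) / ?n)\<^sup>2 = 0"
      using that(2) by (subst (asm) sum_nonneg_eq_0_iff) auto
    then show ?thesis
      using q[OF that(1)] A unfolding level_count_eq_sum by (auto simp: field_simps)
  qed
  show "(\<Sum>i<dim_row A. of_bool (A $$ (i, j) = u) * of_bool (A $$ (i, k) = v))
        = ?n / (real (q j) * real (q k))"
    if "j < p" "k < p" "j \<noteq> k" "u \<in> {1..q j}" "v \<in> {1..q k}" for j k u v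
  proof -
    have "(\<Sum>k\<in>{..<p} - {j}. ?T j k) = 0"
      using sums(2) that(1) by (subst (asm) sum_nonneg_eq_0_iff) (auto intro!: sum_nonneg)
    then have "?T j k = 0"
      using that(2,3) by (subst (asm) sum_nonneg_eq_0_iff) (auto intro!: sum_nonneg)
    then have "(\<Sum>v=1..q k. real (q j) * real (q k) *
        (1 / (real (q j) * real (q k)) - real (pair_count A j k u v) / ?n)\<^sup>2) = 0"
      using that(4) by (subst (asm) sum_nonneg_eq_0_iff) (auto intro!: sum_nonneg)
    then have "real (q j) * real (q k) *
        (1 / (real (q j) * real (q k)) - real (pair_count A j k u v) / ?n)\<^sup>2 = 0"
      using that(5) by (subst (asm) sum_nonneg_eq_0_iff) auto
    then show ?thesis
      using q[OF that(1)] q[OF that(2)] A unfolding pair_count_eq_sum by (auto simp: field_simps)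
  qed
qed

text \<open>This is the equation \<open>Z\<^sub>s\<^sup>T * Z\<^sub>s\<close> w = z(x), one
  coordinate at a time. Balance makes one- and two-predictor frequencies uniform, so only the
  predictor on which \<open>\<phi>\<close> depends leaves a contribution.\<close>

lemma balanced_kernel_reproducing:
  assumes imb: "imbalance p q A = 0" and A: "A \<in> carrier_mat n p" "n \<ge> 1"
    and x: "x \<in> level_combinations p q" and \<phi>: "\<phi> \<in> set (dummy_functions p q)"
  shows "(\<Sum>i<n. \<phi> (row A i) * balanced_kernel p q n x (row A i)) = \<phi> x"
proof -
  have xq: "x $ j \<in> {1..q j}" if "j < p" for j
    using x that by (auto simp: level_combinations_def)
  then have q: "q j \<ge> 1" if "j < p" for j
    using that by fastforce
  have row: "row A i $ j = A $$ (i, j)" if "i < n" "j < p" for i j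
    using A that by simp
  have dim: "dim_row A = n" "dim_row A \<ge> 1"
    using A by auto
  note bal = imbalance_eq_0D[OF imb q dim(2), unfolded dim(1)]
  \<comment> \<open>Exchanging the sums leaves \<open>f\<close> summed alone and against single
    indicators; for a dummy function these are level and pair counts.\<close>
  have expand: "(\<Sum>i<n. f i * balanced_kernel p q n x (row A i)) =
      ((\<Sum>i<n. f i) + (\<Sum>j<p. real (q j) * (\<Sum>i<n. f i * of_bool (A $$ (i, j) = x $ j)) - (\<Sum>i<n. f i))) / n"
    for f :: "nat \<Rightarrow> real"
  proof -
    have "(\<Sum>i<n. f i * balanced_kernel p q n x (row A i)) =
      (\<Sum>i<n. f i + (\<Sum>j<p. real (q j) * (f i * of_bool (A $$ (i, j) = x $ j)) - f i)) / n"
      unfolding sum_divide_distrib balanced_kernel_def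
      by (intro sum.cong refl)
        (simp add: row sum_distrib_left distrib_left right_diff_distrib mult_ac)
    also have "(\<Sum>i<n. f i + (\<Sum>j<p. real (q j) * (f i * of_bool (A $$ (i, j) = x $ j)) - f i)) =
      (\<Sum>i<n. f i) + (\<Sum>j<p. \<Sum>i<n. real (q j) * (f i * of_bool (A $$ (i, j) = x $ j)) - f i)"
      unfolding sum.distrib by (simp add: sum.swap[of _ "{..<p}" "{..<n}"])
    finally show ?thesis
      by (simp only: sum_subtractf sum_distrib_left)
  qed
  from \<phi> consider "\<phi> = (\<lambda>_. 1)"
    | k u where "\<phi> = (\<lambda>x. of_bool (x $ k = u))" "k < p" "1 \<le> u" "u < q k"
    by (auto simp: set_dummy_functions)
  then show ?thesis
  proof cases
    case 1
    \<comment> \<open>Every level occurs n / q_j times, so each predictor contributes 0 and the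
      leading term n / n = 1 remains.\<close>
    have "real (q j) * (\<Sum>i<n. of_bool (A $$ (i, j) = x $ j)) - real n = 0" if "j < p" for j
      using bal(1)[OF _ that xq[OF that]] q[OF that] by simp
    then show ?thesis
      using A(2) expand[of "\<lambda>_. 1"] by (simp add: 1)
  next
    case (2 k u)
    let ?f = "\<lambda>i. of_bool (A $$ (i, k) = u) :: real"
    have u: "u \<in> {1..q k}" using 2 by simp
    have sum_f: "(\<Sum>i<n. ?f i) = real n / real (q k)"
      using bal(1)[OF _ 2(2) u] by simp
    \<comment> \<open>For \<open>j \<noteq> k\<close> pair balance gives q_j n / (q_j q_k) = n /
      q_k, which cancels the subtracted sum. The leftover - n / q_k of \<open>j = k\<close> will
      cancel the leading sum in \<open>expand\<close>.\<close>
    have "real (q j) * (\<Sum>i<n. ?f i * of_bool (A $$ (i, j) = x $ j)) - (\<Sum>i<n. ?f i)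
        = (if j = k then real n * of_bool (x $ k = u) - real n / real (q k) else 0)" if j: "j < p" for j
    proof (cases "j = k")
      case True
      \<comment> \<open>In rows with level \<open>u\<close> at predictor \<open>k\<close>, the
        second indicator is constantly that of \<open>x $ k = u\<close>.\<close>
      have "(\<Sum>i<n. ?f i * of_bool (A $$ (i, j) = x $ j)) = of_bool (x $ k = u) * (\<Sum>i<n. ?f i)"
        unfolding sum_distrib_left True by (intro sum.cong) auto
      then show ?thesis
        using q[OF j] by (simp add: True sum_f)
    next
      case False
      then show ?thesis
        using bal(2)[OF _ 2(2) j _ u xq[OF j]] q[OF j] q[OF 2(2)] by (simp add: sum_f)
    qed
    then have "(\<Sum>j<p. real (q j) * (\<Sum>i<n. ?f i * of_bool (A $$ (i, j) = x $ j)) - (\<Sum>i<n. ?f i))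
        = real n * of_bool (x $ k = u) - real n / real (q k)"
      using 2(2) by simp
    then have "(\<Sum>i<n. ?f i * balanced_kernel p q n x (row A i)) = of_bool (x $ k = u)"
      unfolding expand using A(2) by (simp add: sum_f)
    then show ?thesis
      using 2(2) by (simp add: 2(1) row)
  qed
qed

text \<open>The vector \<open>w\<close> representing the kernel at \<open>x\<close> solves the
  normal equations with right-hand side z(x). So \<open>B\<close> maps z(x) to \<open>w\<close>, and
  the leverage is the kernel on the diagonal.\<close>

lemma balanced_leverage:
  fixes Z B :: "real mat"
  assumes imb: "imbalance p q A = 0" and A: "A \<in> carrier_mat n p" "n \<ge> 1"
    and levels: "\<And>i. i < n \<Longrightarrow> row A i \<in> level_combinations p q"
    and x: "x \<in> level_combinations p q"
    and Z: "Z \<in> carrier_mat n (num_params p q)"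
    and Z_row: "\<And>i. i < n \<Longrightarrow> row Z i = dummy_code p q (row A i)"
    and B: "B \<in> carrier_mat (num_params p q) (num_params p q)"
    and inv: "B * (Z\<^sup>T * Z) = 1\<^sub>m (num_params p q)"
  shows "scalar_prod (dummy_code p q x) (B *\<^sub>v dummy_code p q x) = real (num_params p q) / real n"
proof -
  let ?Q = "num_params p q"
  obtain w where w: "w \<in> carrier_vec ?Q"
    and Kw: "\<And>y. y \<in> level_combinations p q \<Longrightarrow>
      balanced_kernel p q n x y = scalar_prod (dummy_code p q y) w"
    using balanced_kernel_additive[OF x, of n] by (auto simp: additive_functions_def)
  \<comment> \<open>The entries of \<open>Z *\<^sub>v w\<close> are kernel values at the subsample
    points, so applying \<open>Z\<^sup>T\<close> produces the sums of the reproducing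
    property.\<close>
  have Zw: "(Z *\<^sub>v w) $ i = balanced_kernel p q n x (row A i)" if "i < n" for i
    using Z that levels by (simp add: Kw Z_row)
  have "Z\<^sup>T *\<^sub>v (Z *\<^sub>v w) = dummy_code p q x"
  proof (rule eq_vecI)
    fix a assume "a < dim_vec (dummy_code p q x)"
    then have a: "a < ?Q" using dummy_code_carrier[of p q x] by simp
    have "(Z\<^sup>T *\<^sub>v (Z *\<^sub>v w)) $ a = (\<Sum>i<n. Z $$ (i, a) * (Z *\<^sub>v w) $ i)"
      using a Z by (simp add: scalar_prod_def[of _ "Z *\<^sub>v w"] atLeast0LessThan)
    also have "\<dots> = (\<Sum>i<n. (dummy_functions p q ! a) (row A i) * balanced_kernel p q n x (row A i))"
    proof (intro sum.cong refl, goal_cases)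
      case (1 i)
      then have "Z $$ (i, a) = row Z i $ a"
        using a Z by simp
      then show ?case
        using 1 a by (simp only: lessThan_iff Zw Z_row dummy_code_index)
    qed
    also have "\<dots> = (dummy_functions p q ! a) x"
      using a by (intro balanced_kernel_reproducing[OF imb A x]) (simp add: length_dummy_functions)
    finally show "(Z\<^sup>T *\<^sub>v (Z *\<^sub>v w)) $ a = dummy_code p q x $ a"
      using a by (simp add: dummy_code_index)
  qed (use Z dummy_code_carrier[of p q x] in simp)
  then have "B *\<^sub>v dummy_code p q x = B *\<^sub>v ((Z\<^sup>T * Z) *\<^sub>v w)"
    using Z w by (simp add: assoc_mult_mat_vec[of _ ?Q n _ ?Q])
  also have "\<dots> = (B * (Z\<^sup>T * Z)) *\<^sub>v w"
    using B Z w by (intro assoc_mult_mat_vec[symmetric, of _ ?Q ?Q _ ?Q]) auto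
  also have "\<dots> = w"
    using w by (simp add: inv)
  finally show ?thesis
    using Kw[OF x] balanced_kernel_diagonal[OF x] by simp
qed

section \<open>The mean squared prediction error and its maximum\<close>

text \<open>Makes \<open>Max\<close> over these points a true maximum.\<close>

lemma finite_level_combinations: "finite (level_combinations p q)"
proof (rule finite_subset)
  show "level_combinations p q \<subseteq> vec p ` (PiE {..<p} (\<lambda>j. {1..q j}))"
  proof
    fix x assume "x \<in> level_combinations p q"
    then show "x \<in> vec p ` (PiE {..<p} (\<lambda>j. {1..q j}))"
      by (intro image_eqI[of _ _ "restrict (($) x) {..<p}"])
        (auto simp: level_combinations_def)
  qed
qed (auto intro!: finite_PiE)

theorem theorem3:
  fixes N p n :: nat and q :: "nat \<Rightarrow> nat"
    and X X\<^sub>s :: "nat mat" and Z Z\<^sub>s :: "real mat" and s :: "nat list"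
    and P :: "'a measure" and \<sigma> :: real and \<beta> :: "real vec"
    and \<epsilon> :: "nat \<Rightarrow> 'a \<Rightarrow> real" and y\<^sub>s :: "'a \<Rightarrow> real vec" and Y :: "nat vec \<Rightarrow> 'a \<Rightarrow> real"
  defines "\<X> \<equiv> level_combinations p q"
    and "Q \<equiv> num_params p q"
    and "Z \<equiv> model_matrix p q X"
    and "X\<^sub>s \<equiv> select_rows X s"
    and "Z\<^sub>s \<equiv> select_rows Z s"
    and "y\<^sub>s \<equiv> (\<lambda>\<omega>. Z\<^sub>s *\<^sub>v \<beta> + vec n (\<lambda>i. \<epsilon> i \<omega>))"
  assumes X_dim: "X \<in> carrier_mat N p"
    and X_levels: "\<And>i. i < N \<Longrightarrow> row X i \<in> \<X>"
    and full_nonsing: "invertible_mat (Z\<^sup>T * Z)"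
    and n_pos: "n \<ge> 1"
    and s_len: "length s = n"
    and s_dist: "distinct s"
    and s_range: "set s \<subseteq> {..<N}"
    and sub_nonsing: "invertible_mat (Z\<^sub>s\<^sup>T * Z\<^sub>s)"
    and beta_dim: "\<beta> \<in> carrier_vec Q"
    and prob: "prob_space P"
    and eps_indep: "prob_space.indep_vars P (\<lambda>_. borel) \<epsilon> {..<n}"
    and eps_moments: "\<And>i. i < n \<Longrightarrow> prob_space.has_mean_variance P (\<epsilon> i) 0 (\<sigma>\<^sup>2)"
    and Y_moments: "\<And>x. x \<in> \<X> \<Longrightarrow>
          prob_space.has_mean_variance P (Y x) (scalar_prod (dummy_code p q x) \<beta>) (\<sigma>\<^sup>2)"
    and Y_indep: "\<And>x. x \<in> \<X> \<Longrightarrow> prob_space.indep_of_vec P (Y x) n y\<^sub>s"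
  defines "mspe \<equiv> (\<lambda>x. prob_space.expectation P
            (\<lambda>\<omega>. (Y x \<omega> - scalar_prod (dummy_code p q x) (ols_estimate Z\<^sub>s (y\<^sub>s \<omega>)))\<^sup>2))"
  shows "Max (mspe ` \<X>) \<ge> \<sigma>\<^sup>2 * (1 + real Q / real n) \<and>
         (imbalance p q X\<^sub>s = 0 \<longrightarrow> Max (mspe ` \<X>) = \<sigma>\<^sup>2 * (1 + real Q / real n))"
proof -
  interpret prob_space P by (rule prob)
  have Z: "Z \<in> carrier_mat N Q" and row_Z: "\<And>i. i < N \<Longrightarrow> row Z i = dummy_code p q (row X i)"
    using X_dim dummy_code_carrier by (auto simp: Z_def Q_def model_matrix_def)
  have s_less: "s ! i < N" if "i < n" for i
    using s_range s_len that nth_mem by fastforce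
  have Xs: "X\<^sub>s \<in> carrier_mat n p"
    and row_Xs: "\<And>i. i < n \<Longrightarrow> row X\<^sub>s i = row X (s ! i)"
    using X_dim s_len s_less by (auto simp: X\<^sub>s_def select_rows_def)
  have Zs: "Z\<^sub>s \<in> carrier_mat n Q"
    and row_Zs: "\<And>i. i < n \<Longrightarrow> row Z\<^sub>s i = dummy_code p q (row X\<^sub>s i)"
    using Z s_len s_less row_Z dummy_code_carrier[of p q]
    by (auto simp: Z\<^sub>s_def select_rows_def row_Xs Q_def)
  have levels: "row X\<^sub>s i \<in> \<X>" if "i < n" for i
    using X_levels s_less that by (simp add: row_Xs)
  have fin: "finite \<X>"
    by (simp add: \<X>_def finite_level_combinations)
  have nonempty: "\<X> \<noteq> {}"
    using levels[of 0] n_pos by auto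
  obtain A where A: "mat_inverse (Z\<^sub>s\<^sup>T * Z\<^sub>s) = Some A" "A \<in> carrier_mat Q Q"
      "A * (Z\<^sub>s\<^sup>T * Z\<^sub>s) = 1\<^sub>m Q"
    using mat_inverse_Some[of "Z\<^sub>s\<^sup>T * Z\<^sub>s" Q] Zs sub_nonsing by auto
  \<comment> \<open>The leverage of \<open>x\<close>: the variance of its prediction in units of
    \<open>\<sigma>\<^sup>2\<close>.\<close>
  define h where "h x = scalar_prod (dummy_code p q x) (A *\<^sub>v dummy_code p q x)" for x
  have mspe: "mspe x = \<sigma>\<^sup>2 * (1 + h x)" if x: "x \<in> \<X>" for x
  proof -
    let ?z = "dummy_code p q x"
    let ?e = "\<lambda>\<omega>. vec n (\<lambda>i. \<epsilon> i \<omega>)"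
    define c where "c = Z\<^sub>s *\<^sub>v (A\<^sup>T *\<^sub>v ?z)"
    \<comment> \<open>The deviation of the prediction at \<open>x\<close> from its mean, as a linear
      combination of the errors.\<close>
    define L where "L \<omega> = (\<Sum>i<n. c $ i * \<epsilon> i \<omega>)" for \<omega>
    have z: "?z \<in> carrier_vec Q"
      unfolding Q_def by (rule dummy_code_carrier)
    have c: "c \<in> carrier_vec n"
      using Zs A(2) z by (simp add: c_def)
    have cL: "scalar_prod c (?e \<omega>) = L \<omega>" for \<omega>
      by (simp add: scalar_prod_def L_def atLeast0LessThan)
    have pred: "scalar_prod ?z (ols_estimate Z\<^sub>s (y\<^sub>s \<omega>)) = scalar_prod ?z \<beta> + L \<omega>" for \<omega>
      using ols_prediction(1)[OF Zs A(2,3) z beta_dim, of "?e \<omega>"]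
      by (simp add: ols_estimate_def A(1) y\<^sub>s_def c_def[symmetric] cL)
    have cc: "(\<Sum>i<n. (c $ i)\<^sup>2) = h x"
      using ols_prediction(2)[OF Zs A(2,3) z beta_dim zero_carrier_vec] c
      by (simp add: h_def c_def[symmetric] scalar_prod_def[of c] atLeast0LessThan power2_eq_square)
    have L_moments: "has_mean_variance L 0 (\<sigma>\<^sup>2 * h x)"
      using has_mean_variance_linear_combination[OF eps_indep eps_moments, of "($) c"]
      by (simp add: cc L_def[abs_def])
    \<comment> \<open>\<open>Y x\<close> is assumed independent of the response vector rather than
      of the errors; \<open>?g\<close> recovers \<open>L\<close> from the responses by subtracting
      their means.\<close>
    let ?g = "\<lambda>f. (\<Sum>i<n. c $ i * (f i - (Z\<^sub>s *\<^sub>v \<beta>) $ i))"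
    have "?g \<in> borel_measurable (Pi\<^sub>M {..<n} (\<lambda>_. borel))"
      by measurable
    moreover have "?g (\<lambda>i\<in>{..<n}. y\<^sub>s \<omega> $ i) = L \<omega>" for \<omega>
      unfolding L_def y\<^sub>s_def using Zs by (intro sum.cong) auto
    ultimately have "indep_var borel (Y x) borel L"
      using indep_of_vec_imp_indep_var[OF Y_indep[OF x], of ?g] by simp
    from mean_square_prediction_error[OF this Y_moments[OF x] L_moments]
    show ?thesis
      by (simp add: mspe_def pred algebra_simps)
  qed
  have le_Max: "\<sigma>\<^sup>2 * (1 + h x) \<le> Max (mspe ` \<X>)" if "x \<in> \<X>" for x
    using fin that by (subst mspe[OF that, symmetric]) (intro Max_ge; simp)
  have "real Q = (\<Sum>i<n. h (row X\<^sub>s i))"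
    using sum_leverages[OF Zs A(2,3)] by (simp add: row_Zs h_def)
  \<comment> \<open>The sum runs over row indices, so repeated points count with multiplicity; each
    of the \<open>n\<close> terms is at most the maximum.\<close>
  then have "\<sigma>\<^sup>2 * (real n + real Q) = (\<Sum>i<n. \<sigma>\<^sup>2 * (1 + h (row X\<^sub>s i)))"
    by (simp add: sum.distrib flip: sum_distrib_left)
  also have "\<dots> \<le> (\<Sum>i<n. Max (mspe ` \<X>))"
    using levels le_Max by (intro sum_mono) auto
  finally have lower: "\<sigma>\<^sup>2 * (1 + real Q / real n) \<le> Max (mspe ` \<X>)"
    using n_pos by (simp add: field_simps)
  have "Max (mspe ` \<X>) = \<sigma>\<^sup>2 * (1 + real Q / real n)" if imb: "imbalance p q X\<^sub>s = 0"
  proof -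
    have "h x = real Q / real n" if "x \<in> \<X>" for x
      using balanced_leverage[OF imb Xs n_pos, of x Z\<^sub>s A] levels that Zs row_Zs A(2,3)
      by (simp add: h_def Q_def \<X>_def)
    \<comment> \<open>The error is constant on \<open>\<X>\<close>, which is nonempty, so the
      maximum is that constant.\<close>
    then have "mspe ` \<X> = (\<lambda>_. \<sigma>\<^sup>2 * (1 + real Q / real n)) ` \<X>"
      by (intro image_cong) (auto simp: mspe)
    then show ?thesis
      using nonempty by (simp add: image_constant_conv)
  qed
  with lower show ?thesis by blast
qed

end
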